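(* Let $G(q)$ be the formal power series defined in the context. If $f=\sum_{i\ge0}f_iq^i$ is a formal power series with real coefficients such that $\Delta^{(\ell)}_n(f)=\Delta^{(\ell)}_n(G)$ for all $n\ge 0$ and all $\ell\in\{0,1,2,3\}$, i.e. the four sequences $\Delta^{(\ell)}_n(f)$, $\ell=0,1,2,3$, are $4$-antiperiodic ($\Delta^{(\ell)}_{n+4}(f)=-\Delta^{(\ell)}_n(f)$) with first eight terms $\Delta^{(0)}_n(f):\ 1,1,1,0,-1,-1,-1,0$; $\Delta^{(1)}_n(f):\ 1,0,-1,1,-1,0,1,-1$; $\Delta^{(2)}_n(f):\ 1,1,1,0,-1,-1,-1,0$; $\Delta^{(3)}_n(f):\ 1,-1,0,0,-1,1,0,0$, then $f=G$.
   Context: $G(q)\in\mathbb{Z}[[q]]$ is the Taylor expansion at $q=0$ of $\frac{q^2+q-1+\sqrt{(1-q+q^2)(1+3q+q^2)}}{2q}$ (square-root branch equal to $1$ at $q=0$); equivalently, the unique formal power series satisfying $q\,G(q)^2+(1-q-q^2)G(q)=1$. For a power series $f=\sum_{i\ge0}f_iq^i$ and integers $\ell,n\ge 0$, $\Delta^{(\ell)}_n(f)$ is the determinant of the $n\times n$ matrix $(f_{\ell+i+j})_{0\le i,j\le n-1}$, with $\Delta^{(\ell)}_0(f)=1$. *)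

theory Defs
  imports
    "HOL-Computational_Algebra.Formal_Power_Series"
    "Jordan_Normal_Form.Determinant"
begin

text \<open>
  The square root is the formal one with constant coefficient \<open>root 2 1 = 1\<close>. The numerator of
  \<open>G_fps\<close> has constant coefficient \<open>0\<close>, so the division by \<open>2 q\<close> is exact
  (see \<open>G_fps_closed_form\<close>).
\<close>

definition G_fps :: "real fps" where
  "G_fps =
     (fps_X ^ 2 + fps_X - 1
        + fps_radical root 2 ((1 - fps_X + fps_X ^ 2) * (1 + 3 * fps_X + fps_X ^ 2)))
     / (2 * fps_X)"

definition hankel_det :: "nat \<Rightarrow> nat \<Rightarrow> real fps \<Rightarrow> real" where
  "hankel_det l n f = det (mat n n (\<lambda>(i, j). fps_nth f (l + i + j)))"

lemma hankel_det_0: "hankel_det l 0 f = 1"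
  by (simp add: hankel_det_def)

lemma G_fps_closed_form:
  "2 * fps_X * G_fps = fps_X ^ 2 + fps_X - 1
     + fps_radical root 2 ((1 - fps_X + fps_X ^ 2) * (1 + 3 * fps_X + fps_X ^ 2))"
  (is "_ = ?N")
proof -
  have N0: "fps_nth ?N 0 = 0"
    by (simp add: power2_eq_square)
  have "fps_X dvd ?N"
  proof
    show "?N = fps_X * fps_shift 1 ?N"
      by (rule fps_ext) (use N0 in \<open>auto simp: fps_X_mult_nth\<close>)
  qed
  moreover have "is_unit (2 :: real fps)"
    by (simp add: fps_is_unit_iff fps_numeral_nth_0)
  ultimately have "2 * fps_X dvd ?N"
    by (simp add: mult_unit_dvd_iff')
  then show ?thesis
    unfolding G_fps_def by (rule dvd_mult_div_cancel)
qed

lemma G_fps_eq: "fps_X * G_fps ^ 2 + (1 - fps_X - fps_X ^ 2) * G_fps = 1"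
proof -
  define R :: "real fps"
    where "R = fps_radical root 2 ((1 - fps_X + fps_X ^ 2) * (1 + 3 * fps_X + fps_X ^ 2))"
  have R2: "R ^ 2 = (1 - fps_X + fps_X ^ 2) * (1 + 3 * fps_X + fps_X ^ 2)"
    unfolding R_def
    using power_radical[of "(1 - fps_X + fps_X ^ 2) * (1 + 3 * fps_X + fps_X ^ 2) :: real fps" root 1]
    by (simp add: numeral_2_eq_2)
  have "R = 2 * fps_X * G_fps - (fps_X ^ 2 + fps_X - 1)"
    using G_fps_closed_form by (simp add: R_def)
  with R2 have "(2 * fps_X * G_fps - (fps_X ^ 2 + fps_X - 1)) ^ 2
      = (1 - fps_X + fps_X ^ 2) * (1 + 3 * fps_X + fps_X ^ 2)"
    by simp
  then have "(4 * fps_X) * (fps_X * G_fps ^ 2 + (1 - fps_X - fps_X ^ 2) * G_fps) = (4 * fps_X) * 1"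
    by (simp add: algebra_simps power2_eq_square)
  then show ?thesis
    by (subst (asm) mult_left_cancel) auto
qed

lemma G_fps_unique:
  fixes g :: "real fps"
  assumes "fps_X * g ^ 2 + (1 - fps_X - fps_X ^ 2) * g = 1"
  shows "g = G_fps"
proof -
  have "(g - G_fps) * (fps_X * (g + G_fps) + 1 - fps_X - fps_X ^ 2) = 0"
    using arg_cong2[OF assms G_fps_eq, of "(-)"] by (simp add: algebra_simps power2_eq_square)
  moreover have "fps_nth (fps_X * (g + G_fps) + 1 - fps_X - fps_X ^ 2) 0 \<noteq> 0"
    by (simp add: power2_eq_square)
  then have "fps_X * (g + G_fps) + 1 - fps_X - fps_X ^ 2 \<noteq> 0"
    by (metis fps_zero_nth)
  ultimately show ?thesis
    by simp
qed

lemma G_fps_Ints: "fps_nth G_fps n \<in> \<int>"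
proof (induction n rule: less_induct)
  case (less n)
  have "G_fps = 1 + fps_X * G_fps + fps_X * (fps_X * G_fps) - fps_X * (G_fps * G_fps)"
    using G_fps_eq by (simp add: algebra_simps power2_eq_square)
  then have "fps_nth G_fps n =
      fps_nth (1 + fps_X * G_fps + fps_X * (fps_X * G_fps) - fps_X * (G_fps * G_fps)) n"
    by simp
  also have "\<dots> = (if n = 0 then 1 else 0) + (if n = 0 then 0 else fps_nth G_fps (n - 1))
      + (if n \<le> 1 then 0 else fps_nth G_fps (n - 2))
      - (if n = 0 then 0 else \<Sum>i=0..n - 1. fps_nth G_fps i * fps_nth G_fps (n - 1 - i))"
    by (simp add: fps_X_mult_nth fps_mult_nth[of G_fps G_fps] numeral_2_eq_2)
  also have "\<dots> \<in> \<int>"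
    using less by (auto intro!: Ints_add Ints_diff Ints_sum Ints_mult)
  finally show ?case .
qed

end

theory Submission
  imports Defs
begin

text \<open>
  If \<open>f d = q\<^sup>k\<close>, the congruence of the Hankel matrix of \<open>f\<close> by the lower triangular Toeplitz matrix
  of \<open>d\<close> splits off an antitriangular block of size \<open>k + 1\<close> and leaves minus the Hankel matrix of
  \<open>d\<close> shifted by \<open>k + 2\<close>. Write \<open>S\<^sub>l\<close> for \<open>G\<close> shifted by \<open>l\<close>. Up to sign, these steps lead
  from \<open>S\<^sub>0\<close> and from \<open>S\<^sub>2\<close> to \<open>S\<^sub>1 - 1\<close>, from there to \<open>S\<^sub>1\<close>, and from \<open>S\<^sub>1\<close> back to
  \<open>S\<^sub>2\<close>; from \<open>S\<^sub>3\<close> two steps lead back to \<open>S\<^sub>3\<close>. Each cycle reduces the size by \<open>4\<close>, which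
  gives the antiperiodicity for \<open>G\<close>.

  Conversely, the coefficient of index \<open>l + 2 n\<close> occurs in the Hankel determinant of shift \<open>l\<close> and
  size \<open>n + 1\<close> only in the last entry, with the determinant of size \<open>n\<close> as its cofactor. For every
  index one of the available choices (\<open>l = 0, 2\<close> for even, \<open>l = 1, 3\<close> for odd indices) has a
  nonzero cofactor, so the coefficients are determined one after the other.
\<close>

section \<open>Hankel determinants\<close>

lemma hankel_det_fps_shift: "hankel_det l n f = hankel_det 0 n (fps_shift l f)"
  unfolding hankel_det_def by (intro arg_cong[of _ _ det] eq_matI) (auto simp: add_ac)

lemma hankel_det_1: "hankel_det l (Suc 0) f = fps_nth f l"
  by (simp add: hankel_det_def det_single)

lemma hankel_det_uminus: "hankel_det l n (- f) = (-1) ^ n * hankel_det l n f"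
proof -
  have "mat n n (\<lambda>(i, j). fps_nth (- f) (l + i + j)) =
      (-1) \<cdot>\<^sub>m mat n n (\<lambda>(i, j). fps_nth f (l + i + j))"
    by (intro eq_matI) auto
  then show ?thesis
    by (simp add: hankel_det_def)
qed

lemma hankel_det_eq_0:
  assumes "\<And>i. i < k \<Longrightarrow> fps_nth f (l + i) = 0" "0 < n" "n \<le> k"
  shows "hankel_det l n f = 0"
proof -
  have "det (mat n n (\<lambda>(i, j). fps_nth f (l + i + j))) =
      (\<Sum>j<n. mat n n (\<lambda>(i, j). fps_nth f (l + i + j)) $$ (0, j) *
        cofactor (mat n n (\<lambda>(i, j). fps_nth f (l + i + j))) 0 j)"
    by (rule laplace_expansion_row) (use assms in auto)
  also have "\<dots> = 0"
    by (rule sum.neutral) (use assms in auto)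
  finally show ?thesis
    by (simp add: hankel_det_def)
qed

text \<open>The matrix is zero above its antidiagonal and constant on it, so expansion along the
  first row leaves only the last entry. The sign is that of the permutation reversing
  \<open>Suc k\<close> indices.\<close>

lemma hankel_det_fps_X_power_mult:
  "hankel_det 0 (Suc k) (fps_X ^ k * d) = (-1) ^ (k * (k + 1) div 2) * fps_nth d 0 ^ Suc k"
proof (induction k)
  case 0
  show ?case by (simp add: hankel_det_1)
next
  case (Suc k)
  define A where "A = mat (Suc (Suc k)) (Suc (Suc k)) (\<lambda>(i, j). fps_nth (fps_X ^ Suc k * d) (i + j))"
  have "det A = (\<Sum>j<Suc (Suc k). A $$ (0, j) * cofactor A 0 j)"
    by (rule laplace_expansion_row) (auto simp: A_def)
  also have "\<dots> = (\<Sum>j\<in>{Suc k}. A $$ (0, j) * cofactor A 0 j)"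
    by (rule sum.mono_neutral_right) (auto simp: A_def fps_X_power_mult_nth simp del: power_Suc)
  also have "\<dots> = fps_nth d 0 * cofactor A 0 (Suc k)"
    by (simp add: A_def fps_X_power_mult_nth del: power_Suc)
  also have "mat_delete A 0 (Suc k) = mat (Suc k) (Suc k) (\<lambda>(i, j). fps_nth (fps_X ^ k * d) (i + j))"
    by (rule eq_matI) (auto simp: A_def mat_delete_def fps_X_power_mult_nth simp del: power_Suc)
  then have "cofactor A 0 (Suc k) = (-1) ^ Suc k * hankel_det 0 (Suc k) (fps_X ^ k * d)"
    by (simp add: cofactor_def hankel_det_def)
  finally have "hankel_det 0 (Suc (Suc k)) (fps_X ^ Suc k * d) =
      fps_nth d 0 * ((-1) ^ Suc k * hankel_det 0 (Suc k) (fps_X ^ k * d))"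
    by (simp add: hankel_det_def A_def)
  moreover have "Suc k * (Suc k + 1) div 2 = Suc k + k * (k + 1) div 2"
    by simp
  ultimately show ?case
    by (simp only: Suc.IH power_add) (simp add: mult_ac)
qed

text \<open>
  The entries of \<open>T A T\<^sup>t\<close>, where \<open>A\<close> is the Hankel matrix of \<open>f\<close> and \<open>T\<close> the lower triangular
  Toeplitz matrix of \<open>d\<close>. Their generating function is
  \<open>(x d(y) (f d)(x) - y d(x) (f d)(y)) / (x - y)\<close>, which explains \<open>hankel_congr_Suc\<close>.
\<close>

definition hankel_congr :: "real fps \<Rightarrow> real fps \<Rightarrow> nat \<Rightarrow> nat \<Rightarrow> real" where
  "hankel_congr f d i j = (\<Sum>a\<le>i. fps_nth d (i - a) * fps_nth (fps_shift a f * d) j)"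

lemma fps_shift_conv_fps_shift_Suc:
  "fps_shift l (f :: real fps) = fps_const (fps_nth f l) + fps_X * fps_shift (Suc l) f"
  by (rule fps_ext) (auto simp: fps_X_mult_nth)

lemma fps_shift_mult_nth_Suc:
  fixes f d :: "real fps"
  shows "fps_nth (fps_shift a f * d) (Suc j) =
    fps_nth (fps_shift (Suc a) f * d) j + fps_nth f a * fps_nth d (Suc j)"
proof -
  have "fps_shift a f * d = fps_const (fps_nth f a) * d + fps_X * (fps_shift (Suc a) f * d)"
    by (subst fps_shift_conv_fps_shift_Suc) (simp only: ring_distribs mult.assoc)
  then show ?thesis
    by simp
qed

lemma hankel_congr_0: "hankel_congr f d 0 j = fps_nth d 0 * fps_nth (f * d) j"
  by (simp add: hankel_congr_def)

lemma hankel_congr_Suc: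
  "hankel_congr f d (Suc i) j = hankel_congr f d i (Suc j)
     + fps_nth d (Suc i) * fps_nth (f * d) j - fps_nth d (Suc j) * fps_nth (f * d) i"
proof -
  have "hankel_congr f d (Suc i) j = fps_nth d (Suc i) * fps_nth (f * d) j
      + (\<Sum>a\<le>i. fps_nth d (i - a) * fps_nth (fps_shift (Suc a) f * d) j)"
    unfolding hankel_congr_def by (subst sum.atMost_Suc_shift) simp
  moreover have "hankel_congr f d i (Suc j) =
      (\<Sum>a\<le>i. fps_nth d (i - a) * fps_nth (fps_shift (Suc a) f * d) j)
      + fps_nth d (Suc j) * (\<Sum>a\<le>i. fps_nth f a * fps_nth d (i - a))"
    unfolding hankel_congr_def fps_shift_mult_nth_Suc
    by (simp add: ring_distribs sum.distrib sum_distrib_left mult_ac)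
  moreover have "(\<Sum>a\<le>i. fps_nth f a * fps_nth d (i - a)) = fps_nth (f * d) i"
    by (simp add: fps_mult_nth atLeast0AtMost)
  ultimately show ?thesis
    by simp
qed

text \<open>For \<open>f * d = fps_X ^ k\<close> the two correction terms of
  \<open>hankel_congr_Suc\<close> vanish unless \<open>i = k\<close> or \<open>j = k\<close>. Hence
  entries are constant along antidiagonals except where a row or column index crosses
  \<open>k\<close>, which produces the block shape.\<close>

lemma hankel_congr_eq:
  assumes "f * d = fps_X ^ k"
  shows "hankel_congr f d i j =
    (if i \<le> k \<and> j \<le> k then fps_nth (fps_X ^ k * d) (i + j)
     else if i > k \<and> j > k then - fps_nth d (i + j - k) else 0)"
proof (induction i arbitrary: j)
  case 0
  show ?case
    by (auto simp: hankel_congr_0 assms fps_X_power_mult_nth)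
next
  case (Suc i)
  show ?case
    unfolding hankel_congr_Suc Suc.IH assms
    by (auto simp: fps_X_power_mult_nth not_le Suc_diff_le less_Suc_eq)
qed

text \<open>The congruence multiplies the determinant by that of the triangular matrix twice, each
  time contributing the \<open>n\<close>-th power of the diagonal entry
  \<open>fps_nth d 0\<close>.\<close>

lemma det_hankel_congr:
  "det (mat n n (\<lambda>(i, j). hankel_congr f d i j)) = fps_nth d 0 ^ (2 * n) * hankel_det 0 n f"
proof -
  define A where "A = mat n n (\<lambda>(i, j). fps_nth f (i + j))"
  define T where "T = mat n n (\<lambda>(i, j). if j \<le> i then fps_nth d (i - j) else 0)"
  have [simp]: "A \<in> carrier_mat n n" "T \<in> carrier_mat n n"
    by (auto simp: A_def T_def)
  have AT: "(A * transpose_mat T) $$ (a, j) = fps_nth (fps_shift a f * d) j"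
    if "a < n" "j < n" for a j
  proof -
    have "(A * transpose_mat T) $$ (a, j) =
        (\<Sum>b<n. fps_nth f (a + b) * (if b \<le> j then fps_nth d (j - b) else 0))"
      using that by (simp add: A_def T_def scalar_prod_def atLeast0LessThan)
    also have "\<dots> = (\<Sum>b\<le>j. fps_nth f (a + b) * fps_nth d (j - b))"
      by (rule sum.mono_neutral_cong_right) (use that in auto)
    finally show ?thesis
      by (simp add: fps_mult_nth atLeast0AtMost add_ac)
  qed
  have "mat n n (\<lambda>(i, j). hankel_congr f d i j) = T * (A * transpose_mat T)"
  proof (rule eq_matI)
    fix i j assume "i < dim_row (T * (A * transpose_mat T))" "j < dim_col (T * (A * transpose_mat T))"
    then have ij: "i < n" "j < n"
      by (auto simp: T_def A_def)
    have "(T * (A * transpose_mat T)) $$ (i, j) =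
        (\<Sum>a<n. T $$ (i, a) * (A * transpose_mat T) $$ (a, j))"
      using ij by (simp add: A_def T_def scalar_prod_def atLeast0LessThan)
    also have "\<dots> = (\<Sum>a<n. (if a \<le> i then fps_nth d (i - a) else 0) * fps_nth (fps_shift a f * d) j)"
      by (rule sum.cong) (use ij AT in \<open>auto simp: T_def\<close>)
    also have "\<dots> = hankel_congr f d i j"
      unfolding hankel_congr_def by (rule sum.mono_neutral_cong_right) (use ij in auto)
    finally show "mat n n (\<lambda>(i, j). hankel_congr f d i j) $$ (i, j) = (T * (A * transpose_mat T)) $$ (i, j)"
      using ij by simp
  qed (auto simp: T_def A_def)
  moreover have "det T = fps_nth d 0 ^ n"
    by (subst det_lower_triangular[of n]) (auto simp: T_def prod_list_diag_prod)
  moreover have "det (T * (A * transpose_mat T)) = det T * (det A * det T)"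
    by (simp add: det_mult[where n = n] det_transpose[of _ n] mult_carrier_mat[of _ n n _ n])
  ultimately show ?thesis
    by (simp add: hankel_det_def mult_2 power_add flip: A_def)
qed

text \<open>One step of a Hankel continued fraction in the sense of Gessel--Xin and Han.\<close>

lemma hankel_det_fraction_step:
  assumes "f * d = fps_X ^ k"
  shows "fps_nth d 0 ^ (2 * (Suc k + n)) * hankel_det 0 (Suc k + n) f =
    (-1) ^ (k * (k + 1) div 2) * fps_nth d 0 ^ Suc k * (-1) ^ n * hankel_det (k + 2) n d"
proof -
  define P where "P = mat (Suc k) (Suc k) (\<lambda>(i, j). fps_nth (fps_X ^ k * d) (i + j))"
  define Q where "Q = mat n n (\<lambda>(i, j). fps_nth (- d) (k + 2 + i + j))"
  \<comment> \<open>The lower right block starts at index \<open>Suc k\<close> in both directions,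
    so its index \<open>k + 2\<close> plus the two block coordinates equals
    \<open>i + j - k\<close>. Truncated subtraction requires this explicit identity.\<close>
  have [simp]: "Suc (i + j - Suc k) = i + j - k" if "\<not> i < Suc k" for i j
    using that by simp
  have "mat (Suc k + n) (Suc k + n) (\<lambda>(i, j). hankel_congr f d i j) =
      four_block_mat P (0\<^sub>m (Suc k) n) (0\<^sub>m n (Suc k)) Q"
    by (rule eq_matI) (auto simp: hankel_congr_eq[OF assms] P_def Q_def algebra_simps)
  then have "det (mat (Suc k + n) (Suc k + n) (\<lambda>(i, j). hankel_congr f d i j)) = det P * det Q"
    by (simp only:) (rule det_four_block_mat_upper_right_zero, auto simp: P_def Q_def)
  moreover have "det P = (-1) ^ (k * (k + 1) div 2) * fps_nth d 0 ^ Suc k"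
    using hankel_det_fps_X_power_mult[of k d] by (simp add: hankel_det_def P_def)
  moreover have "det Q = (-1) ^ n * hankel_det (k + 2) n d"
    using hankel_det_uminus[of "k + 2" n d] by (simp add: hankel_det_def Q_def)
  ultimately show ?thesis
    by (simp only: det_hankel_congr mult.assoc)
qed

section \<open>Recovering coefficients, and antiperiodic sequences\<close>

lemma fps_nth_eq_if_hankel_det_eq:
  assumes agree: "\<And>i. i < l + 2 * n \<Longrightarrow> fps_nth f i = fps_nth g i"
    and eq: "hankel_det l (Suc n) f = hankel_det l (Suc n) g"
    and nz: "hankel_det l n g \<noteq> 0"
  shows "fps_nth f (l + 2 * n) = fps_nth g (l + 2 * n)"
proof -
  define A where "A h = mat (Suc n) (Suc n) (\<lambda>(i, j). fps_nth h (l + i + j))" for h :: "real fps"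
  have expand: "hankel_det l (Suc n) h =
      (\<Sum>j<n. fps_nth h (l + n + j) * cofactor (A h) n j) + fps_nth h (l + 2 * n) * hankel_det l n h" for h
  proof -
    have "hankel_det l (Suc n) h = (\<Sum>j<Suc n. A h $$ (n, j) * cofactor (A h) n j)"
      unfolding hankel_det_def A_def[symmetric]
      by (rule laplace_expansion_row) (auto simp: A_def)
    also have "\<dots> = (\<Sum>j<n. fps_nth h (l + n + j) * cofactor (A h) n j)
        + fps_nth h (l + 2 * n) * cofactor (A h) n n"
      by (simp add: A_def mult_2 add_ac)
    also have "mat_delete (A h) n n = mat n n (\<lambda>(i, j). fps_nth h (l + i + j))"
      by (rule eq_matI) (auto simp: A_def mat_delete_def)
    then have "cofactor (A h) n n = hankel_det l n h"
      by (simp add: cofactor_def hankel_det_def)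
    finally show ?thesis .
  qed
  \<comment> \<open>Without the last row, all indices are at most \<open>l + 2 * n - 1\<close>,
    hence in the range where \<open>f\<close> and \<open>g\<close> agree.\<close>
  have "mat_delete (A f) n j = mat_delete (A g) n j" if "j \<le> n" for j
    by (rule eq_matI) (use that in \<open>auto simp: A_def mat_delete_def intro!: agree\<close>)
  then have "(\<Sum>j<n. fps_nth f (l + n + j) * cofactor (A f) n j) =
      (\<Sum>j<n. fps_nth g (l + n + j) * cofactor (A g) n j)"
    by (intro sum.cong) (auto simp: cofactor_def agree)
  moreover have "hankel_det l n f = hankel_det l n g"
    unfolding hankel_det_def by (intro arg_cong[of _ _ det] eq_matI) (auto intro!: agree)
  ultimately show ?thesis
    using eq nz by (simp add: expand)
qed

lemma antiperiodic_eqI: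
  fixes a b :: "nat \<Rightarrow> real"
  assumes "\<And>n. a (n + 4) = - a n" "\<And>n. b (n + 4) = - b n"
    and "a 0 = b 0" "a 1 = b 1" "a 2 = b 2" "a 3 = b 3"
  shows "a n = b n"
proof (induction n rule: less_induct)
  case (less n)
  have "n = 0 \<or> n = 1 \<or> n = 2 \<or> n = 3 \<or> n \<ge> 4"
    by linarith
  then consider "n = 0" | "n = 1" | "n = 2" | "n = 3" | m where "n = m + 4"
    using le_Suc_ex by (metis add.commute)
  then show ?case
    by cases (use assms less in auto)
qed

lemma antiperiodic_nonzero:
  fixes a :: "nat \<Rightarrow> real"
  assumes "\<And>n. a (n + 4) = - a n" "a (n mod 4) \<noteq> 0"
  shows "a n \<noteq> 0"
proof -
  have "a (r + 4 * q) = (-1) ^ q * a r" for r q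
    by (induction q) (use assms(1)[of "r + 4 * _"] in \<open>simp_all add: algebra_simps\<close>)
  from this[of "n mod 4" "n div 4"] assms(2) show ?thesis
    by simp
qed

section \<open>The series \<open>G\<close>\<close>

lemma G_fps_nth: "fps_nth G_fps 0 = 1" "fps_nth G_fps 1 = 0" "fps_nth G_fps 2 = 1"
  "fps_nth G_fps 3 = -1"
proof -
  have eq: "G_fps = 1 + fps_X * (G_fps + fps_X * G_fps - G_fps * G_fps)"
    using G_fps_eq by (simp add: algebra_simps power2_eq_square)
  have S: "fps_nth G_fps (Suc n) =
      fps_nth G_fps n + fps_nth (fps_X * G_fps) n - fps_nth (G_fps * G_fps) n" for n
    using arg_cong[OF eq, of "\<lambda>h. fps_nth h (Suc n)"] by simp
  show 0: "fps_nth G_fps 0 = 1"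
    using arg_cong[OF eq, of "\<lambda>h. fps_nth h 0"] by simp
  show 1: "fps_nth G_fps 1 = 0"
    using S[of 0] 0 by simp
  show 2: "fps_nth G_fps 2 = 1"
    using S[of 1] 0 1 by (simp add: fps_mult_nth numeral_eq_Suc)
  show "fps_nth G_fps 3 = -1"
    using S[of 2] 0 1 2 by (simp add: fps_mult_nth numeral_eq_Suc)
qed

section \<open>Quadratic equations and continued fraction steps for the shifts of
  \<open>G_fps\<close>\<close>

lemma G_fps_shifts:
  "G_fps = 1 + fps_X * fps_shift 1 G_fps"
  "fps_shift 1 G_fps = fps_X * fps_shift 2 G_fps"
  "fps_shift 2 G_fps = 1 + fps_X * fps_shift 3 G_fps"
  using fps_shift_conv_fps_shift_Suc[of 0 G_fps] fps_shift_conv_fps_shift_Suc[of 1 G_fps]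
    fps_shift_conv_fps_shift_Suc[of 2 G_fps] G_fps_nth
  by (simp_all add: numeral_2_eq_2 numeral_3_eq_3)

text \<open>Substituting \<open>G_fps_shifts(1)\<close> into \<open>G_fps_eq\<close> leaves a common
  factor \<open>fps_X\<close>, which is cancelled. The next two equations arise in the same way from
  their predecessors.\<close>

lemma fps_shift_1_G_fps_eq:
  "fps_shift 1 G_fps * (1 + fps_X - fps_X ^ 2 + fps_X ^ 2 * fps_shift 1 G_fps) = fps_X"
proof -
  have "fps_X * (fps_shift 1 G_fps * (1 + fps_X - fps_X ^ 2 + fps_X ^ 2 * fps_shift 1 G_fps)) =
      fps_X * fps_X"
    using G_fps_eq G_fps_shifts(1) by Groebner_Basis.algebra
  then show ?thesis
    by (subst (asm) mult_left_cancel) auto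
qed

lemma fps_shift_2_G_fps_eq:
  "fps_shift 2 G_fps * (1 + fps_X - fps_X ^ 2 + fps_X ^ 3 * fps_shift 2 G_fps) = 1"
proof -
  have "fps_X * (fps_shift 2 G_fps * (1 + fps_X - fps_X ^ 2 + fps_X ^ 3 * fps_shift 2 G_fps)) =
      fps_X * 1"
    using fps_shift_1_G_fps_eq unfolding G_fps_shifts(2)
    by (simp add: power2_eq_square power3_eq_cube mult_ac)
  then show ?thesis
    by (subst (asm) mult_left_cancel) auto
qed

text \<open>This is the quadratic equation of the third shift multiplied by
  \<open>1 + 2 * fps_X\<close>. Dividing by the second factor isolates the polynomial part
  \<open>- 1 - 2 * fps_X\<close> of the reciprocal of the shift, as the first of its two fraction
  steps needs.\<close>

lemma fps_shift_3_G_fps_eq: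
  "(1 + (1 + 2 * fps_X) * fps_shift 3 G_fps) *
     (1 + fps_X - fps_X ^ 2 + 2 * fps_X ^ 3 + fps_X ^ 4 * fps_shift 3 G_fps) =
   fps_X ^ 4 * fps_shift 3 G_fps"
proof -
  have "fps_X * ((1 + (1 + 2 * fps_X) * fps_shift 3 G_fps) *
     (1 + fps_X - fps_X ^ 2 + 2 * fps_X ^ 3 + fps_X ^ 4 * fps_shift 3 G_fps)) =
   fps_X * (fps_X ^ 4 * fps_shift 3 G_fps)"
    using fps_shift_2_G_fps_eq G_fps_shifts(3) by Groebner_Basis.algebra
  then show ?thesis
    by (subst (asm) mult_left_cancel) auto
qed

text \<open>Here \<open>u\<close> is a polynomial of degree at most \<open>k + 1\<close>, so the
  shift of the denominator by \<open>k + 2\<close> is exactly \<open>g\<close>; since its constant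
  term is 1 or -1, the even power on the left of \<open>hankel_det_fraction_step\<close> is
  1.\<close>

lemma hankel_det_fraction_step_unit:
  assumes "f * (u + fps_X ^ (k + 2) * g) = fps_X ^ k"
    and "\<And>i. i \<ge> k + 2 \<Longrightarrow> fps_nth u i = 0"
    and "fps_nth u 0 ^ 2 = 1"
  shows "hankel_det 0 (Suc k + n) f =
    (-1) ^ (k * (k + 1) div 2) * fps_nth u 0 ^ Suc k * (-1) ^ n * hankel_det 0 n g"
proof -
  have "fps_shift (k + 2) (u + fps_X ^ (k + 2) * g) = g"
    using assms(2) by (intro fps_ext) (simp add: fps_X_power_mult_nth del: power_Suc add_2_eq_Suc')
  moreover have "fps_nth (u + fps_X ^ (k + 2) * g) 0 = fps_nth u 0"
    by (simp add: fps_X_power_mult_nth del: power_Suc add_2_eq_Suc')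
  ultimately show ?thesis
    using hankel_det_fraction_step[OF assms(1), of n] assms(3)
    by (simp only: hankel_det_fps_shift[of "k + 2"] power_mult power_one mult_1)
qed

lemma hankel_det_G_fps_step:
  "hankel_det 0 (Suc n) G_fps = (-1) ^ n * hankel_det 0 n (fps_shift 1 G_fps - 1)"
proof -
  have "G_fps * (1 + fps_X ^ (0 + 2) * (fps_shift 1 G_fps - 1)) = fps_X ^ 0"
    unfolding add_0 power_0 using G_fps_eq G_fps_shifts(1) by Groebner_Basis.algebra
  from hankel_det_fraction_step_unit[OF this] show ?thesis
    by simp
qed

text \<open>The remainder is minus the first shift; negating it cancels the \<open>(-1) ^ n\<close>
  of the step, so only the sign of the constant term -1 of the denominator survives.\<close>

lemma hankel_det_shift_1_G_fps_diff_step: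
  "hankel_det 0 (Suc n) (fps_shift 1 G_fps - 1) = - hankel_det 1 n G_fps"
proof -
  have "(fps_shift 1 G_fps - 1) * ((- 1 - fps_X) + fps_X ^ (0 + 2) * (- fps_shift 1 G_fps)) = fps_X ^ 0"
    using fps_shift_1_G_fps_eq by (simp add: algebra_simps power2_eq_square)
  from hankel_det_fraction_step_unit[OF this] show ?thesis
    by (simp add: hankel_det_uminus hankel_det_fps_shift[of "Suc 0"] fps_X_nth flip: power_mult_distrib)
qed

text \<open>The first shift has order one, so \<open>k = 1\<close> and the size drops by
  two.\<close>

lemma hankel_det_shift_1_G_fps_step:
  "hankel_det 1 (Suc (Suc n)) G_fps = - ((-1) ^ n * hankel_det 2 n G_fps)"
proof -
  have "fps_shift 1 G_fps * ((1 + fps_X - fps_X ^ 2) + fps_X ^ (1 + 2) * fps_shift 2 G_fps) = fps_X ^ 1"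
    using fps_shift_1_G_fps_eq G_fps_shifts(2) by (simp add: power2_eq_square power3_eq_cube mult_ac)
  from hankel_det_fraction_step_unit[OF this] show ?thesis
    by (simp add: hankel_det_fps_shift[of "Suc 0"] hankel_det_fps_shift[of 2] fps_X_nth)
qed

text \<open>The remainder is the same as for \<open>G_fps\<close> itself, so the determinants of
  shifts 0 and 2 coincide.\<close>

lemma hankel_det_shift_2_G_fps_step:
  "hankel_det 2 (Suc n) G_fps = (-1) ^ n * hankel_det 0 n (fps_shift 1 G_fps - 1)"
proof -
  have "fps_shift 2 G_fps * ((1 + fps_X) + fps_X ^ (0 + 2) * (fps_shift 1 G_fps - 1)) = fps_X ^ 0"
    using fps_shift_2_G_fps_eq unfolding G_fps_shifts(2)
    by (simp add: algebra_simps power2_eq_square power3_eq_cube)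
  from hankel_det_fraction_step_unit[OF this] show ?thesis
    by (simp add: hankel_det_fps_shift[of 2] fps_X_nth)
qed

text \<open>The series \<open>t\<close> is the remainder between a step with \<open>k = 0\<close>
  and one with \<open>k = 2\<close>. Its two vanishing coefficients supply the zeros among the
  initial values for shift 3.\<close>

lemma hankel_det_shift_3_G_fps_steps:
  obtains t where
    "\<And>n. hankel_det 3 (Suc n) G_fps = - ((-1) ^ n * hankel_det 0 n t)"
    "\<And>n. hankel_det 0 (n + 3) t = - ((-1) ^ n * hankel_det 3 n G_fps)"
    "fps_nth t 0 = 0" "fps_nth t 1 = 0"
proof
  \<comment> \<open>The second factor in \<open>fps_shift_3_G_fps_eq\<close>, split for the step
    with \<open>k = 2\<close> into a polynomial of degree 3 and a multiple of
    \<open>fps_X ^ 4\<close>.\<close>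
  define w where "w = (1 + fps_X - fps_X ^ 2 + 2 * fps_X ^ 3) + fps_X ^ (2 + 2) * fps_shift 3 G_fps"
  define t where "t = fps_X ^ 2 * inverse w"
  have w0: "fps_nth w 0 \<noteq> 0"
    by (simp add: w_def fps_X_power_mult_nth)
  then have "w \<noteq> 0"
    by auto
  have tw: "t * w = fps_X ^ 2"
    using inverse_mult_eq_1[OF w0] by (simp add: t_def mult.assoc)
  show "fps_nth t 0 = 0" "fps_nth t 1 = 0"
    by (simp_all add: t_def fps_X_power_mult_nth)
  have "w * (fps_shift 3 G_fps * ((- 1 - 2 * fps_X) + fps_X ^ (0 + 2) * t)) = w * 1"
  proof -
    have "(1 + (1 + 2 * fps_X) * fps_shift 3 G_fps) * w = fps_X ^ 4 * fps_shift 3 G_fps"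
      using fps_shift_3_G_fps_eq by (simp add: w_def)
    then show ?thesis
      using tw unfolding add_0 by Groebner_Basis.algebra
  qed
  with \<open>w \<noteq> 0\<close> have "fps_shift 3 G_fps * ((- 1 - 2 * fps_X) + fps_X ^ (0 + 2) * t) = fps_X ^ 0"
    by (subst (asm) mult_left_cancel) auto
  from hankel_det_fraction_step_unit[OF this]
  show "hankel_det 3 (Suc n) G_fps = - ((-1) ^ n * hankel_det 0 n t)" for n
    by (simp add: hankel_det_fps_shift[of 3] fps_X_nth numeral_fps_const)
  from hankel_det_fraction_step_unit[OF tw[unfolded w_def]]
  show "hankel_det 0 (n + 3) t = - ((-1) ^ n * hankel_det 3 n G_fps)" for n
    by (simp add: hankel_det_fps_shift[of 3] fps_X_nth numeral_fps_const add.commute[of n])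
qed

section \<open>Antiperiodicity and initial values for \<open>G_fps\<close>\<close>

lemma hankel_det_G_fps_antiperiodic:
  assumes "l \<in> {0, 1, 2, 3}"
  shows "hankel_det l (n + 4) G_fps = - hankel_det l n G_fps"
proof -
  have 4: "n + 4 = Suc (Suc (Suc (Suc n)))" for n
    by simp
  have 2: "hankel_det 2 (n + 4) G_fps = - hankel_det 2 n G_fps" for n
    by (simp add: 4 hankel_det_shift_2_G_fps_step hankel_det_shift_1_G_fps_diff_step
        hankel_det_shift_1_G_fps_step del: One_nat_def)
  have 0: "hankel_det 0 n G_fps = hankel_det 2 n G_fps" for n
    by (cases n) (simp_all add: hankel_det_0 hankel_det_G_fps_step hankel_det_shift_2_G_fps_step)
  have 1: "hankel_det 1 (n + 4) G_fps = - hankel_det 1 n G_fps" for n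
    by (simp add: 4 hankel_det_shift_2_G_fps_step hankel_det_shift_1_G_fps_diff_step
        hankel_det_shift_1_G_fps_step del: One_nat_def)
  have 3: "hankel_det 3 (n + 4) G_fps = - hankel_det 3 n G_fps" for n
  proof -
    obtain t where t: "\<And>n. hankel_det 3 (Suc n) G_fps = - ((-1) ^ n * hankel_det 0 n t)"
      "\<And>n. hankel_det 0 (n + 3) t = - ((-1) ^ n * hankel_det 3 n G_fps)"
      by (rule hankel_det_shift_3_G_fps_steps) blast
    have "hankel_det 3 (n + 4) G_fps = - ((-1) ^ (n + 3) * hankel_det 0 (n + 3) t)"
      using t(1)[of "n + 3"] by (simp add: numeral_eq_Suc)
    then show ?thesis
      by (simp add: t(2) power_add)
  qed
  show ?thesis
    using assms 0 1 2 3 by auto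
qed

lemma hankel_det_G_fps_initial:
  "hankel_det 0 1 G_fps = 1" "hankel_det 0 2 G_fps = 1" "hankel_det 0 3 G_fps = 0"
  "hankel_det 1 1 G_fps = 0" "hankel_det 1 2 G_fps = -1" "hankel_det 1 3 G_fps = 1"
  "hankel_det 2 1 G_fps = 1" "hankel_det 2 2 G_fps = 1" "hankel_det 2 3 G_fps = 0"
  "hankel_det 3 1 G_fps = -1" "hankel_det 3 2 G_fps = 0" "hankel_det 3 3 G_fps = 0"
proof -
  have 1: "hankel_det l 1 G_fps = fps_nth G_fps l" for l
    by (simp add: hankel_det_1)
  show "hankel_det 0 1 G_fps = 1" "hankel_det 1 1 G_fps = 0" "hankel_det 2 1 G_fps = 1"
    "hankel_det 3 1 G_fps = -1"
    by (simp_all only: 1 G_fps_nth)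
  have 3: "3 = Suc (Suc 1)"
    by simp
  note steps = hankel_det_0 hankel_det_G_fps_step hankel_det_shift_2_G_fps_step
    hankel_det_shift_1_G_fps_diff_step hankel_det_shift_1_G_fps_step 1 G_fps_nth
  show "hankel_det 0 2 G_fps = 1" "hankel_det 1 2 G_fps = -1" "hankel_det 2 2 G_fps = 1"
    using steps(2-5)[of 1] steps(2-5)[of 0] by (simp_all add: steps numeral_2_eq_2)
  show "hankel_det 0 3 G_fps = 0" "hankel_det 1 3 G_fps = 1" "hankel_det 2 3 G_fps = 0"
    using steps(2-5)[of 2] steps(2-5)[of 1] 1[of 1] 1[of 2] G_fps_nth
    by (simp_all add: 3 numeral_2_eq_2)
  obtain t where t: "\<And>n. hankel_det 3 (Suc n) G_fps = - ((-1) ^ n * hankel_det 0 n t)"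
    "fps_nth t 0 = 0" "fps_nth t 1 = 0"
    by (rule hankel_det_shift_3_G_fps_steps) blast
  \<comment> \<open>For these sizes the first row uses only the coefficients 0 and 1 of
    \<open>t\<close>.\<close>
  have "hankel_det 0 n t = 0" if "0 < n" "n \<le> 2" for n
    by (rule hankel_det_eq_0[of 2]) (use that t in \<open>auto simp: less_2_cases_iff\<close>)
  then show "hankel_det 3 2 G_fps = 0" "hankel_det 3 3 G_fps = 0"
    using t(1)[of 1] t(1)[of 2] t(2) by (simp_all add: numeral_eq_Suc)
qed

section \<open>Determination of the series by its Hankel determinants\<close>

lemma eq_G_fps_if_hankel_det_eq:
  assumes "\<And>l n. l \<in> {0, 1, 2, 3} \<Longrightarrow> hankel_det l n f = hankel_det l n G_fps"
  shows "f = G_fps"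
proof (rule fps_ext)
  fix m
  show "fps_nth f m = fps_nth G_fps m"
  proof (induction m rule: less_induct)
    case (less m)
    have step: "fps_nth f m = fps_nth G_fps m"
      if "m = l + 2 * n" "l \<in> {0, 1, 2, 3}" "hankel_det l (n mod 4) G_fps \<noteq> 0" for l n
    proof -
      have "hankel_det l n G_fps \<noteq> 0"
        by (rule antiperiodic_nonzero[of "\<lambda>n. hankel_det l n G_fps"])
          (use that hankel_det_G_fps_antiperiodic in auto)
      with that less assms show ?thesis
        using fps_nth_eq_if_hankel_det_eq[of l n f G_fps] by auto
    qed
    define s where "s = m div 2"
    have s: "s mod 4 = 0 \<or> s mod 4 = 1 \<or> s mod 4 = 2 \<or> s mod 4 = 3"
      by linarith
    note vals = hankel_det_0 hankel_det_G_fps_initial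
    show ?case
    proof (cases "even m")
      case True
      then have m: "m = 2 * s"
        by (simp add: s_def)
      show ?thesis
      \<comment> \<open>For shift 0 the determinants of sizes 0 to 3 are 1, 1, 1, 0, so only residue
        3 fails. There shift 2 with size \<open>s - 1\<close>, of residue 2, has a nonzero
        determinant.\<close>
      proof (cases "s mod 4 = 3")
        case True
        then obtain r where "s = Suc r" "r mod 4 = 2"
          by (cases s) (auto simp: mod_Suc split: if_splits)
        then show ?thesis
          using step[of 2 r] m vals by simp
      next
        case False
        then show ?thesis
          using s step[of 0 s] m vals by auto
      qed
    next
      case False
      then have m: "m = 1 + 2 * s"
        by (simp add: s_def)
      show ?thesis
      \<comment> \<open>For shift 1 the values are 1, 0, -1, 1, so only residue 1 fails. There shift
        3 with size \<open>s - 1\<close>, of residue 0, has a nonzero determinant.\<close>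
      proof (cases "s mod 4 = 1")
        case True
        then obtain r where "s = Suc r" "r mod 4 = 0"
          by (cases s) (auto simp: mod_Suc split: if_splits)
        then show ?thesis
          using step[of 3 r] m vals by simp
      next
        case False
        then show ?thesis
          using s step[of 1 s] m vals by auto
      qed
    qed
  qed
qed

theorem theorem1p7:
  fixes f :: "real fps"
  shows
    "((\<forall>l \<in> {0, 1, 2, 3}. \<forall>n. hankel_det l n f = hankel_det l n G_fps)
        \<longleftrightarrow>
      (\<forall>l \<in> {0, 1, 2, 3}. \<forall>n. hankel_det l (n + 4) f = - hankel_det l n f) \<and>
      map (\<lambda>n. hankel_det 0 n f) [0..<8] = [1, 1, 1, 0, -1, -1, -1, 0] \<and>
      map (\<lambda>n. hankel_det 1 n f) [0..<8] = [1, 0, -1, 1, -1, 0, 1, -1] \<and>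
      map (\<lambda>n. hankel_det 2 n f) [0..<8] = [1, 1, 1, 0, -1, -1, -1, 0] \<and>
      map (\<lambda>n. hankel_det 3 n f) [0..<8] = [1, -1, 0, 0, -1, 1, 0, 0])
     \<and>
     ((\<forall>l \<in> {0, 1, 2, 3}. \<forall>n. hankel_det l n f = hankel_det l n G_fps) \<longrightarrow> f = G_fps)"
    (is "(?eq \<longleftrightarrow> ?per \<and> ?init) \<and> _")
proof (intro conjI iffI impI)
  \<comment> \<open>The last four indices are written as sums with 4 so that antiperiodicity
    rewrites them directly.\<close>
  have upt: "[0..<8] = [0, 1, 2, 3, 0 + 4, 1 + 4, 2 + 4, 3 + 4]"
    by (simp add: upt_rec)
  show "f = G_fps" if ?eq
    using that by (intro eq_G_fps_if_hankel_det_eq) blast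
  show ?per if ?eq
    using that hankel_det_G_fps_antiperiodic by simp
  show "map (\<lambda>n. hankel_det 0 n f) [0..<8] = [1, 1, 1, 0, -1, -1, -1, 0]"
    "map (\<lambda>n. hankel_det 1 n f) [0..<8] = [1, 0, -1, 1, -1, 0, 1, -1]"
    "map (\<lambda>n. hankel_det 2 n f) [0..<8] = [1, 1, 1, 0, -1, -1, -1, 0]"
    "map (\<lambda>n. hankel_det 3 n f) [0..<8] = [1, -1, 0, 0, -1, 1, 0, 0]" if ?eq
    using that hankel_det_G_fps_antiperiodic
    by (simp_all only: upt list.map insert_iff simp_thms ball_simps hankel_det_0
        hankel_det_G_fps_initial minus_minus minus_zero)
  assume rhs: "?per \<and> ?init"
  have init: "hankel_det l 0 f = hankel_det l 0 G_fps \<and> hankel_det l 1 f = hankel_det l 1 G_fps \<and>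
      hankel_det l 2 f = hankel_det l 2 G_fps \<and> hankel_det l 3 f = hankel_det l 3 G_fps"
    if "l \<in> {0, 1, 2, 3}" for l
    using that rhs
    by (elim insertE emptyE; simp only: upt list.map list.inject hankel_det_0 hankel_det_G_fps_initial simp_thms)
  show ?eq
  proof (intro ballI allI)
    fix l n assume l: "l \<in> {0, 1, 2, 3 :: nat}"
    show "hankel_det l n f = hankel_det l n G_fps"
      by (rule antiperiodic_eqI[of "\<lambda>n. hankel_det l n f" "\<lambda>n. hankel_det l n G_fps"])
        (use init[OF l] bspec[OF conjunct1[OF rhs] l] hankel_det_G_fps_antiperiodic[OF l] in simp_all)
  qed
qed

end
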